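(* Let $A$ be a finite abelian group. (i) $(\Delta A)^2$ has a lattice basis (i.e. a $\mathbb{Z}$-basis) consisting of elements of the form $(a-1)(b-1)$ with $a,b\in A$. (ii) If either $|A|>4$ or $A\cong C_2\times C_2$, then $(\Delta A)^2$ has a lattice basis consisting of elements of length $2$.
   Context: $A$ is written multiplicatively; $\mathbb{Z}A$ is its integral group ring, and $\Delta A=\{\sum_{a\in A} r_a a\in\mathbb{Z}A : \sum_a r_a=0\}$ is the augmentation ideal. $(\Delta A)^2$ is the additive subgroup of $\mathbb{Z}A$ generated by all products $xy$ with $x,y\in\Delta A$. The length of $x=\sum_a x_a a$ is $\|x\|=\sqrt{\sum_a x_a^2}$. $C_2$ is the cyclic group of order $2$. *)

theory Defs
  imports "HOL-Algebra.Algebra" Complex_Main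
begin

text \<open>
  The integral group ring of \<open>G\<close>. Its additive group is the library's free abelian group on
  \<open>carrier G\<close>: the elements are the formal sums \<open>x :: 'a \<Rightarrow>\<^sub>0 int\<close> supported on \<open>carrier G\<close>,
  and \<open>frag_of a\<close> is the group element \<open>a\<close> regarded as an element of the ring.
  Multiplication is the bilinear extension of the multiplication of \<open>G\<close>; the product of
  \<open>'a \<Rightarrow>\<^sub>0 int\<close> from the library is not used, since it convolves along \<open>(+)\<close> of a type class.
\<close>

definition group_ring_mult ::
    "('a, 'm) monoid_scheme \<Rightarrow> ('a \<Rightarrow>\<^sub>0 int) \<Rightarrow> ('a \<Rightarrow>\<^sub>0 int) \<Rightarrow> ('a \<Rightarrow>\<^sub>0 int)"
  where "group_ring_mult G x y = frag_extend (\<lambda>a. frag_extend (\<lambda>b. frag_of (a \<otimes>\<^bsub>G\<^esub> b)) y) x"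

definition group_ring :: "('a, 'm) monoid_scheme \<Rightarrow> ('a \<Rightarrow>\<^sub>0 int) ring"
  where "group_ring G =
    \<lparr>carrier = {x. Poly_Mapping.keys x \<subseteq> carrier G},
     monoid.mult = group_ring_mult G,
     one = frag_of \<one>\<^bsub>G\<^esub>,
     ring.zero = 0,
     add = (+)\<rparr>"

definition aug_ideal :: "('a, 'm) monoid_scheme \<Rightarrow> ('a \<Rightarrow>\<^sub>0 int) set"
  where "aug_ideal G =
    {x \<in> carrier (group_ring G). (\<Sum>a\<in>Poly_Mapping.keys x. Poly_Mapping.lookup x a) = 0}"

definition aug_ideal_sq :: "('a, 'm) monoid_scheme \<Rightarrow> ('a \<Rightarrow>\<^sub>0 int) set"
  where "aug_ideal_sq G =
    generate (add_monoid (group_ring G))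
      {x \<otimes>\<^bsub>group_ring G\<^esub> y | x y. x \<in> aug_ideal G \<and> y \<in> aug_ideal G}"

definition group_ring_length :: "('a \<Rightarrow>\<^sub>0 int) \<Rightarrow> real"
  where "group_ring_length x =
    sqrt (\<Sum>a\<in>Poly_Mapping.keys x. (real_of_int (Poly_Mapping.lookup x a))\<^sup>2)"

text \<open>The formal sums as a \<open>\<int>\<close>-module, which provides \<open>frag.independent\<close> and \<open>frag.span\<close>.\<close>

interpretation frag: Modules.module "frag_cmul :: int \<Rightarrow> ('a \<Rightarrow>\<^sub>0 int) \<Rightarrow> ('a \<Rightarrow>\<^sub>0 int)"
  by unfold_locales (simp_all add: frag_cmul_distrib frag_cmul_distrib2)

definition lattice_basis :: "('a \<Rightarrow>\<^sub>0 int) set \<Rightarrow> ('a \<Rightarrow>\<^sub>0 int) set \<Rightarrow> bool"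
  where "lattice_basis B L \<longleftrightarrow> frag.independent B \<and> frag.span B = L"

text \<open>The definitions do give a commutative ring and an ideal of it.\<close>

lemma group_ring_simps [simp]:
  "carrier (group_ring G) = {x. Poly_Mapping.keys x \<subseteq> carrier G}"
  "x \<otimes>\<^bsub>group_ring G\<^esub> y = group_ring_mult G x y"
  "\<one>\<^bsub>group_ring G\<^esub> = frag_of \<one>\<^bsub>G\<^esub>"
  "\<zero>\<^bsub>group_ring G\<^esub> = 0"
  "x \<oplus>\<^bsub>group_ring G\<^esub> y = x + y"
  by (simp_all add: group_ring_def)

lemma group_ring_mult_frag_of [simp]:
  "group_ring_mult G (frag_of a) (frag_of b) = frag_of (a \<otimes>\<^bsub>G\<^esub> b)"
  by (simp add: group_ring_mult_def)

lemma frag_extend_fun_add: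
  "frag_extend (\<lambda>a. f a + g a) x = frag_extend f x + frag_extend g x"
  by (simp add: frag_extend_def frag_cmul_distrib2 sum.distrib)

lemma frag_extend_fun_diff:
  "frag_extend (\<lambda>a. f a - g a) x = frag_extend f x - frag_extend g x"
  by (simp add: frag_extend_def frag.scale_right_diff_distrib sum_subtractf)

lemma group_ring_mult_add_left:
  "group_ring_mult G (x + y) z = group_ring_mult G x z + group_ring_mult G y z"
  by (simp add: group_ring_mult_def frag_extend_add)

lemma group_ring_mult_add_right:
  "group_ring_mult G z (x + y) = group_ring_mult G z x + group_ring_mult G z y"
  by (simp add: group_ring_mult_def frag_extend_add frag_extend_fun_add)

lemma group_ring_mult_diff_left:
  "group_ring_mult G (x - y) z = group_ring_mult G x z - group_ring_mult G y z"
  by (simp add: group_ring_mult_def frag_extend_diff)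

lemma group_ring_mult_diff_right:
  "group_ring_mult G z (x - y) = group_ring_mult G z x - group_ring_mult G z y"
  by (simp add: group_ring_mult_def frag_extend_diff frag_extend_fun_diff)

lemma group_ring_mult_zero [simp]:
  "group_ring_mult G 0 x = 0" "group_ring_mult G x 0 = 0"
  by (simp_all add: group_ring_mult_def frag_extend_eq_0)

lemma (in monoid) group_ring_mult_closed:
  assumes "Poly_Mapping.keys x \<subseteq> carrier G" "Poly_Mapping.keys y \<subseteq> carrier G"
  shows "Poly_Mapping.keys (group_ring_mult G x y) \<subseteq> carrier G"
proof -
  have "Poly_Mapping.keys (frag_extend (\<lambda>b. frag_of (a \<otimes> b)) y) \<subseteq> carrier G"
    if "a \<in> carrier G" for a
    using that assms(2) keys_frag_extend [of "\<lambda>b. frag_of (a \<otimes> b)" y] by (auto simp: keys_frag_of)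
  then show ?thesis
    unfolding group_ring_mult_def
    using assms(1) keys_frag_extend [of "\<lambda>a. frag_extend (\<lambda>b. frag_of (a \<otimes> b)) y" x] by blast
qed

lemma (in monoid) group_ring_mult_assoc:
  assumes x: "Poly_Mapping.keys x \<subseteq> carrier G"
    and y: "Poly_Mapping.keys y \<subseteq> carrier G" and z: "Poly_Mapping.keys z \<subseteq> carrier G"
  shows "group_ring_mult G (group_ring_mult G x y) z = group_ring_mult G x (group_ring_mult G y z)"
  using x
proof (induction x rule: frag_induction)
  case (one a)
  from y show ?case
  proof (induction y rule: frag_induction)
    case (one b)
    from z show ?case
      by (induction z rule: frag_induction)
        (use one \<open>a \<in> carrier G\<close> in \<open>simp_all add: m_assoc group_ring_mult_diff_right\<close>)
  qed (simp_all add: group_ring_mult_diff_left group_ring_mult_diff_right)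
qed (simp_all add: group_ring_mult_diff_left)

lemma (in comm_monoid) group_ring_mult_comm:
  assumes x: "Poly_Mapping.keys x \<subseteq> carrier G" and y: "Poly_Mapping.keys y \<subseteq> carrier G"
  shows "group_ring_mult G x y = group_ring_mult G y x"
  using x
proof (induction x rule: frag_induction)
  case (one a)
  from y show ?case
    by (induction y rule: frag_induction)
      (use one in \<open>simp_all add: m_comm group_ring_mult_diff_left group_ring_mult_diff_right\<close>)
qed (simp_all add: group_ring_mult_diff_left group_ring_mult_diff_right)

lemma (in monoid) group_ring_mult_one_left:
  assumes "Poly_Mapping.keys x \<subseteq> carrier G"
  shows "group_ring_mult G (frag_of \<one>) x = x"
  using assms
  by (induction x rule: frag_induction) (simp_all add: group_ring_mult_diff_right)

lemma (in comm_group) cring_group_ring: "cring (group_ring G)"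
proof (rule cringI)
  show "abelian_group (group_ring G)"
  proof (rule abelian_groupI)
    fix x y assume "x \<in> carrier (group_ring G)" "y \<in> carrier (group_ring G)"
    then show "x \<oplus>\<^bsub>group_ring G\<^esub> y \<in> carrier (group_ring G)"
      using Poly_Mapping.keys_add [of x y] by auto
  next
    fix x assume "x \<in> carrier (group_ring G)"
    then show "\<exists>y\<in>carrier (group_ring G). y \<oplus>\<^bsub>group_ring G\<^esub> x = \<zero>\<^bsub>group_ring G\<^esub>"
      by (intro bexI [of _ "- x"]) auto
  qed (auto simp: algebra_simps)
  show "Group.comm_monoid (group_ring G)"
    by (rule comm_monoidI,
        simp_all add: group_ring_mult_closed group_ring_mult_assoc group_ring_mult_one_left)
      (rule group_ring_mult_comm)
  show "(x \<oplus>\<^bsub>group_ring G\<^esub> y) \<otimes>\<^bsub>group_ring G\<^esub> z =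
      x \<otimes>\<^bsub>group_ring G\<^esub> z \<oplus>\<^bsub>group_ring G\<^esub> y \<otimes>\<^bsub>group_ring G\<^esub> z" for x y z
    by (simp add: group_ring_mult_add_left)
qed

lemma sum_lookup_diff:
  "(\<Sum>a\<in>Poly_Mapping.keys (x - y). Poly_Mapping.lookup (x - y) a) =
    (\<Sum>a\<in>Poly_Mapping.keys x. Poly_Mapping.lookup x a) -
    (\<Sum>a\<in>Poly_Mapping.keys y. Poly_Mapping.lookup y a)" for x y :: "'a \<Rightarrow>\<^sub>0 int"
proof -
  let ?K = "Poly_Mapping.keys x \<union> Poly_Mapping.keys y"
  have *: "(\<Sum>a\<in>Poly_Mapping.keys z. Poly_Mapping.lookup z a) = (\<Sum>a\<in>?K. Poly_Mapping.lookup z a)"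
    if "Poly_Mapping.keys z \<subseteq> ?K" for z :: "'a \<Rightarrow>\<^sub>0 int"
    by (rule sum.mono_neutral_left) (use that in \<open>auto simp: in_keys_iff\<close>)
  show ?thesis
    by (subst (1 2 3) *)
      (use keys_diff [of x y] in \<open>auto simp: lookup_minus sum_subtractf\<close>)
qed

lemma sum_lookup_group_ring_mult:
  "(\<Sum>c\<in>Poly_Mapping.keys (group_ring_mult G x y). Poly_Mapping.lookup (group_ring_mult G x y) c) =
    (\<Sum>a\<in>Poly_Mapping.keys x. Poly_Mapping.lookup x a) *
    (\<Sum>b\<in>Poly_Mapping.keys y. Poly_Mapping.lookup y b)" (is "?aug (_ x y) = _")
proof -
  have "Poly_Mapping.keys x \<subseteq> UNIV" and y: "Poly_Mapping.keys y \<subseteq> UNIV"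
    by simp_all
  then show ?thesis
  proof (induction x rule: frag_induction)
    case (one a)
    from y show ?case
      by (induction y rule: frag_induction)
        (simp_all add: group_ring_mult_diff_right sum_lookup_diff)
  qed (simp_all add: group_ring_mult_diff_left sum_lookup_diff left_diff_distrib)
qed

lemma (in comm_group) ideal_aug_ideal: "ideal (aug_ideal G) (group_ring G)"
proof -
  interpret R: cring "group_ring G"
    by (rule cring_group_ring)
  have inv: "inv\<^bsub>add_monoid (group_ring G)\<^esub> x = - x" if "Poly_Mapping.keys x \<subseteq> carrier G" for x
    using R.minus_equality [of "- x" x] that by (simp add: a_inv_def)
  have neg: "- x \<in> aug_ideal G" if "x \<in> aug_ideal G" for x
    using that sum_lookup_diff [of 0 x] by (simp add: aug_ideal_def)
  show ?thesis
  proof (rule idealI)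
    show "ring (group_ring G)"
      by (rule R.ring_axioms)
    show "subgroup (aug_ideal G) (add_monoid (group_ring G))"
    proof
      fix x y assume "x \<in> aug_ideal G" "y \<in> aug_ideal G"
      then show "x \<otimes>\<^bsub>add_monoid (group_ring G)\<^esub> y \<in> aug_ideal G"
        using neg [of y] sum_lookup_diff [of x "- y"] Poly_Mapping.keys_add [of x y]
        by (auto simp: aug_ideal_def)
    next
      fix x assume "x \<in> aug_ideal G"
      then show "inv\<^bsub>add_monoid (group_ring G)\<^esub> x \<in> aug_ideal G"
        using neg inv by (simp add: aug_ideal_def)
    qed (auto simp: aug_ideal_def)
  qed (auto simp: aug_ideal_def sum_lookup_group_ring_mult dest: group_ring_mult_closed [THEN subsetD])
qed

end

theory Submission
  imports Defs "HOL-Library.Function_Algebras"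
begin

text \<open>
  Modulo a subgroup \<open>L\<close> of \<open>\<int>G\<close> containing \<open>(x - 1)(y - 1)\<close>, the map \<open>e x = x - 1\<close> satisfies
  \<open>e (x y) = e x + e y\<close> for these \<open>x, y\<close>. Suppose that \<open>(\<Delta>H)\<^sup>2\<close> is spanned by \<open>|H| - 1\<close>
  products, let \<open>g \<notin> H\<close>, let \<open>m > 0\<close> be minimal with \<open>g^m \<in> H\<close>, and let \<open>k \<in> H\<close>. Then
  \<open>(h g - 1)(h' - 1)\<close>, for the given pairs \<open>(h, h')\<close>, together with \<open>(h - 1)(g^i - 1)\<close> for
  \<open>1 \<noteq> h \<in> H\<close> and \<open>(k g^i - 1)(g - 1)\<close>, where \<open>0 < i < m\<close>, are \<open>|H| m - 1\<close> products that span
  \<open>(\<Delta>\<langle>H, g\<rangle>)\<^sup>2\<close>: they make \<open>e\<close> additive on \<open>H\<close>, give \<open>e (h g^i) = e h + i e g\<close>, and hence make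
  \<open>e\<close> additive everywhere. A spanning set of that size is a basis, as \<open>(\<Delta>G)\<^sup>2\<close> has rank \<open>|G| - 1\<close>.
  This gives (i) by adjoining one element at a time.

  If \<open>k \<noteq> 1\<close> and \<open>k g^m \<noteq> 1\<close>, all the products in this step have length 2, whatever the pairs for
  \<open>H\<close> were. In the last step, which produces \<open>G\<close>, such a \<open>k\<close> exists unless \<open>H \<subseteq> {1, g^-m}\<close>, and then
  \<open>g\<close> generates \<open>G\<close>. For \<open>G\<close> cyclic of order \<open>n \<ge> 5\<close> the products \<open>(g^i - 1)(g - 1)\<close>,
  \<open>2 \<le> i \<le> n - 2\<close>, \<open>(g^(n-1) - 1)(g^2 - 1)\<close> and \<open>(g^(n-1) - 1)(g^3 - 1)\<close> form a basis.
\<close>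

section \<open>Independence over the integers from a rank count\<close>

text \<open>Over the rationals \<open>n\<close> becomes invertible, so the image of \<open>B\<close>
  spans the unit vectors at the points of \<open>Z\<close>. These are \<open>card Z\<close>
  independent vectors, hence a spanning set with at most \<open>card Z\<close> elements cannot be
  dependent. The multiple \<open>n\<close> covers sets \<open>B\<close> whose span only has finite
  index in the formal sums on \<open>Z\<close>.\<close>

lemma frag_independent_if_card_le:
  assumes fin: "finite Z" "finite B" and card: "card B \<le> card Z" and n: "n \<noteq> 0"
    and span: "\<And>x. x \<in> Z \<Longrightarrow> frag_cmul n (frag_of x) \<in> frag.span B"
  shows "frag.independent (B :: ('a \<Rightarrow>\<^sub>0 int) set)"
proof -
  interpret V: vector_space "\<lambda>(c::rat) (f::'a \<Rightarrow> rat) a. c * f a"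
    by unfold_locales (auto simp: fun_eq_iff algebra_simps)
  define emb :: "('a \<Rightarrow>\<^sub>0 int) \<Rightarrow> 'a \<Rightarrow> rat" where "emb x = (\<lambda>a. of_int (Poly_Mapping.lookup x a))" for x
  have emb_add: "emb (x + y) = emb x + emb y" for x y
    by (simp add: emb_def fun_eq_iff lookup_add)
  have emb_cmul: "emb (frag_cmul c x) = (\<lambda>a. of_int c * emb x a)" for c x
    by (simp add: emb_def fun_eq_iff)
  have emb_0: "emb 0 = 0"
    by (simp add: emb_def fun_eq_iff)
  have emb_sum: "emb (sum f T) = (\<Sum>t\<in>T. emb (f t))" for f and T :: "('a \<Rightarrow>\<^sub>0 int) set"
    by (induction T rule: infinite_finite_induct) (simp_all add: emb_0 emb_add)
  have inj: "inj emb"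
    by (auto simp: inj_def emb_def fun_eq_iff intro: poly_mapping_eqI)
  have emb_span: "emb x \<in> V.span (emb ` B)" if "x \<in> frag.span B" for x
    using that
  proof (induction rule: frag.span_induct_alt)
    case base
    show ?case unfolding emb_0 by (rule V.span_zero)
  next
    case (step c x y)
    show ?case
      using V.span_add[OF V.span_scale[OF V.span_base[OF imageI[OF step(1)]], of "of_int c"] step(2)]
      unfolding emb_add emb_cmul .
  qed
  define U where "U = (\<lambda>x. emb (frag_of x)) ` Z"
  have emb_of: "emb (frag_of x) a = (if a = x then 1 else 0)" for x a
    by (simp add: emb_def lookup_single when_def)
  have inj_U: "inj_on (\<lambda>x. emb (frag_of x)) Z"
  proof (rule inj_onI)
    fix x y assume "emb (frag_of x) = emb (frag_of y)"
    from fun_cong[OF this, of x] show "x = y" by (simp add: emb_of split: if_splits)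
  qed
  have U_span: "U \<subseteq> V.span (emb ` B)"
  proof
    fix u assume "u \<in> U"
    then obtain x where x: "x \<in> Z" "u = emb (frag_of x)" by (auto simp: U_def)
    from emb_span[OF span[OF x(1)]] have "(\<lambda>a. of_int n * u a) \<in> V.span (emb ` B)"
      by (simp add: emb_cmul x)
    from V.span_scale[OF this, of "inverse (of_int n)"] show "u \<in> V.span (emb ` B)"
      using n by (simp add: mult.assoc[symmetric])
  qed
  have U_indep: "V.independent U"
  proof (rule V.independent_if_scalars_zero)
    show "finite U" using fin by (simp add: U_def)
    fix f u assume eq: "(\<Sum>u\<in>U. (\<lambda>a. f u * u a)) = 0" and "u \<in> U"
    then obtain x where x: "x \<in> Z" "u = emb (frag_of x)" by (auto simp: U_def)
    have sum_app: "(\<Sum>t\<in>T. h t) a = (\<Sum>t\<in>T. h t a)" for h :: "'a \<Rightarrow> 'a \<Rightarrow> rat" and T a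
      by (induction T rule: infinite_finite_induct) auto
    have "0 = (\<Sum>y\<in>Z. (\<lambda>a. f (emb (frag_of y)) * emb (frag_of y) a)) x"
      using eq by (simp add: U_def sum.reindex[OF inj_U] o_def)
    also have "\<dots> = (\<Sum>y\<in>Z. if y = x then f u else 0)"
      by (auto simp: sum_app emb_of x intro!: sum.cong)
    also have "\<dots> = f u" using x fin by simp
    finally show "f u = 0" by simp
  qed
  have indep: "V.independent (emb ` B)"
  proof (rule ccontr)
    assume "\<not> ?thesis"
    then obtain b where b: "b \<in> emb ` B" "b \<in> V.span (emb ` B - {b})"
      by (auto simp: V.dependent_def)
    then have "V.span (emb ` B - {b}) = V.span (emb ` B)"
      using V.span_redundant[OF b(2)] by (simp add: insert_absorb)
    \<comment> \<open>Steinitz exchange: a redundant \<open>b\<close> would leave a spanning set too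
      small for the independent set \<open>U\<close>.\<close>
    then have "card U \<le> card (emb ` B - {b})"
      using V.independent_span_bound[OF _ U_indep, of "emb ` B - {b}"] U_span fin by auto
    also have "\<dots> < card (emb ` B)"
      using b(1) fin by (intro psubset_card_mono) auto
    also have "\<dots> \<le> card B" using fin by (rule_tac card_image_le)
    finally show False using card by (simp add: U_def card_image[OF inj_U])
  qed
  show ?thesis
    unfolding frag.independent_explicit_module
  proof (intro allI impI)
    fix T u b assume T: "finite T" "T \<subseteq> B" "(\<Sum>v\<in>T. frag_cmul (u v) v) = 0" "b \<in> T"
    have inj_T: "inj_on emb T" using inj by (auto simp: inj_on_def)
    have "emb (\<Sum>v\<in>T. frag_cmul (u v) v) = 0" using T by (simp add: emb_0)
    then have "(\<Sum>v\<in>emb ` T. (\<lambda>a. of_int (u (inv_into UNIV emb v)) * v a)) = 0"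
      by (simp add: sum.reindex[OF inj_T] o_def emb_sum emb_cmul inv_f_f[OF inj])
    from V.independentD[OF indep _ _ this, of "emb b"] T have "of_int (u (inv_into UNIV emb (emb b))) = (0::rat)"
      by blast
    then show "u b = 0" by (simp add: inv_f_f[OF inj])
  qed
qed

section \<open>The products \<open>(x - 1)(y - 1)\<close> and their span\<close>

context comm_group
begin

text \<open>This is \<open>(x - 1)(y - 1)\<close> multiplied out. Read as
  \<open>e (x y) - e x - e y\<close> with \<open>e x = x - 1\<close>, it measures how far
  \<open>e\<close> is from being additive, which is how the span arguments use it.\<close>

definition aug_prod :: "'a \<Rightarrow> 'a \<Rightarrow> ('a \<Rightarrow>\<^sub>0 int)"
  where "aug_prod x y = frag_of (x \<otimes> y) - frag_of x - frag_of y + frag_of \<one>"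

lemma aug_prod_eq_mult:
  assumes "x \<in> carrier G" "y \<in> carrier G"
  shows "aug_prod x y = group_ring_mult G (frag_of x - frag_of \<one>) (frag_of y - frag_of \<one>)"
  using assms
  by (simp add: aug_prod_def group_ring_mult_diff_left group_ring_mult_diff_right algebra_simps)

lemma aug_prod_one [simp]:
  "x \<in> carrier G \<Longrightarrow> aug_prod x \<one> = 0" "x \<in> carrier G \<Longrightarrow> aug_prod \<one> x = 0"
  by (simp_all add: aug_prod_def)

text \<open>The hypotheses make \<open>x\<close>, \<open>y\<close>, \<open>x \<otimes> y\<close> and
  \<open>\<one>\<close> four distinct elements, so exactly four coefficients are nonzero, each of
  them 1 or -1.\<close>

lemma group_ring_length_aug_prod:
  assumes "x \<in> carrier G" "y \<in> carrier G" "x \<noteq> \<one>" "y \<noteq> \<one>" "x \<noteq> y" "x \<otimes> y \<noteq> \<one>"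
  shows "group_ring_length (aug_prod x y) = 2"
proof -
  have four: "group_ring_length (frag_of z - frag_of x - frag_of y + frag_of w) = 2"
    if "distinct [x, y, z, w]" for x y z w :: 'a
  proof -
    let ?f = "Poly_Mapping.lookup (frag_of z - frag_of x - frag_of y + frag_of w)"
    have f: "?f a = (if a = z then 1 else 0) - (if a = x then 1 else 0)
        - (if a = y then 1 else 0) + (if a = w then 1 else 0)" for a
      by (simp add: lookup_add lookup_minus lookup_single when_def)
    have "(\<Sum>a\<in>Poly_Mapping.keys (frag_of z - frag_of x - frag_of y + frag_of w). (real_of_int (?f a))\<^sup>2) =
        (\<Sum>a\<in>{x, y, z, w}. (real_of_int (?f a))\<^sup>2)"
      by (rule sum.mono_neutral_left) (auto simp: in_keys_iff f split: if_splits)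
    also have "\<dots> = 4" using that by (auto simp: f)
    finally show ?thesis by (simp add: group_ring_length_def)
  qed
  show ?thesis
    unfolding aug_prod_def by (rule four) (use assms in \<open>simp add: l_cancel_one' r_cancel_one'\<close>)
qed

text \<open>This connects the generated subgroup in the definition of \<open>aug_ideal_sq\<close>
  with the module span in that of \<open>lattice_basis\<close>.\<close>

lemma generate_add_group_ring:
  assumes Z: "Z \<subseteq> carrier (group_ring G)"
  shows "generate (add_monoid (group_ring G)) Z = frag.span Z"
proof
  interpret R: cring "group_ring G" by (rule cring_group_ring)
  have inv_eq: "inv\<^bsub>add_monoid (group_ring G)\<^esub> x = - x" if "x \<in> carrier (group_ring G)" for x
    using R.minus_equality [of "- x" x] that by (simp add: a_inv_def)
  have one_eq: "\<one>\<^bsub>add_monoid (group_ring G)\<^esub> = 0" and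
    mult_eq: "x \<otimes>\<^bsub>add_monoid (group_ring G)\<^esub> y = x + y" for x y
    by simp_all
  show "generate (add_monoid (group_ring G)) Z \<subseteq> frag.span Z"
  proof
    fix x assume "x \<in> generate (add_monoid (group_ring G)) Z"
    then show "x \<in> frag.span Z"
    proof induction
      case one
      then show ?case using frag.span_zero by simp
    next
      case (incl h)
      then show ?case by (rule frag.span_base)
    next
      case (inv h)
      then show ?case
        unfolding inv_eq[OF subsetD[OF Z inv]] by (intro frag.span_neg frag.span_base)
    next
      case (eng h1 h2)
      then show ?case by (auto intro: frag.span_add)
    qed
  qed
  define S where "S = generate (add_monoid (group_ring G)) Z"
  have sg: "subgroup S (add_monoid (group_ring G))"
    using R.add.generate_is_subgroup Z by (simp add: S_def)
  have zero: "0 \<in> S" using generate.one[of "add_monoid (group_ring G)" Z] unfolding one_eq S_def .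
  have add: "x + y \<in> S" if "x \<in> S" "y \<in> S" for x y
    using generate.eng[OF that[unfolded S_def]] unfolding mult_eq S_def .
  have neg: "- x \<in> S" if "x \<in> S" for x
    using subgroup.m_inv_closed[OF sg that] inv_eq[of x] subgroup.mem_carrier[OF sg that] by simp
  have scale: "frag_cmul c x \<in> S" if "x \<in> S" for c x
  proof (induction c rule: int_induct[of _ 0])
    case base
    then show ?case using zero by simp
  next
    case (step1 i)
    then show ?case using add that by (simp add: frag_cmul_distrib)
  next
    case (step2 i)
    then show ?case using add[OF _ neg[OF that]] by (simp add: frag.scale_left_diff_distrib)
  qed
  have "Z \<subseteq> S"
    unfolding S_def by (blast intro: generate.incl)
  then have "frag.span Z \<subseteq> S"
    by (rule frag.span_minimal) (auto simp: frag.subspace_def zero add scale)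
  then show "frag.span Z \<subseteq> generate (add_monoid (group_ring G)) Z"
    by (simp only: S_def)
qed

lemma aug_ideal_sq_eq_span:
  "aug_ideal_sq G = frag.span {aug_prod x y | x y. x \<in> carrier G \<and> y \<in> carrier G}"
    (is "_ = frag.span ?P")
proof -
  let ?Q = "{group_ring_mult G x y | x y. x \<in> aug_ideal G \<and> y \<in> aug_ideal G}"
  have sq: "aug_ideal_sq G = frag.span ?Q"
    unfolding aug_ideal_sq_def group_ring_simps(2)
    by (rule generate_add_group_ring) (use group_ring_mult_closed in \<open>auto simp: aug_ideal_def\<close>)
  have in_aug: "frag_of x - frag_of \<one> \<in> aug_ideal G" if "x \<in> carrier G" for x
    using that keys_diff[of "frag_of x" "frag_of \<one>"]
    by (auto simp: aug_ideal_def sum_lookup_diff keys_frag_of)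
  have PQ: "?P \<subseteq> ?Q"
    using aug_prod_eq_mult in_aug by blast
  have QP: "?Q \<subseteq> frag.span ?P"
  proof clarify
    fix x y assume xy: "x \<in> aug_ideal G" "y \<in> aug_ideal G"
    define aug where "aug z = (\<Sum>a\<in>Poly_Mapping.keys z. Poly_Mapping.lookup z a)" for z :: "'a \<Rightarrow>\<^sub>0 int"
    \<comment> \<open>Induction on a formal sum leaves the augmentation ideal, so the claim is
      proved for \<open>p x\<close> and \<open>p y\<close> instead. The additive map
      \<open>p\<close> sends \<open>a\<close> to \<open>a - 1\<close> and fixes the ideal.\<close>
    define p where "p z = z - frag_cmul (aug z) (frag_of \<one>)" for z :: "'a \<Rightarrow>\<^sub>0 int"
    have p_diff: "p (u - v) = p u - p v" for u v
      by (simp add: p_def aug_def sum_lookup_diff frag.scale_left_diff_distrib algebra_simps)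
    have p_0: "p 0 = 0" by (simp add: p_def aug_def)
    have p_of: "p (frag_of a) = frag_of a - frag_of \<one>" for a by (simp add: p_def aug_def)
    have kx: "Poly_Mapping.keys x \<subseteq> carrier G" and ky: "Poly_Mapping.keys y \<subseteq> carrier G"
      using xy by (auto simp: aug_ideal_def)
    from kx have "group_ring_mult G (p x) (p y) \<in> frag.span ?P"
    proof (induction x rule: frag_induction)
      case (one a)
      from ky show ?case
      proof (induction y rule: frag_induction)
        case (one b)
        then show ?case using \<open>a \<in> carrier G\<close>
          by (auto simp: p_of aug_prod_eq_mult[symmetric] intro: frag.span_base)
      qed (simp_all add: p_0 p_diff group_ring_mult_diff_right frag.span_zero frag.span_diff)
    qed (simp_all add: p_0 p_diff group_ring_mult_diff_left frag.span_zero frag.span_diff)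
    moreover have "p x = x" "p y = y" using xy by (auto simp: p_def aug_def aug_ideal_def)
    ultimately show "group_ring_mult G x y \<in> frag.span ?P" by simp
  qed
  show ?thesis
    unfolding sq by (rule subset_antisym[OF frag.span_minimal[OF QP frag.subspace_span] frag.span_mono[OF PQ]])
qed

text \<open>Modulo the span, \<open>e x = x - 1\<close> is additive, so \<open>e (x^j)\<close> is
  \<open>j\<close> times \<open>e x\<close>. Taking \<open>j\<close> to be the group order puts a
  nonzero multiple of every \<open>x - 1\<close> into the span.\<close>

lemma pow_aug_in_span:
  fixes j :: nat
  assumes "\<And>x y. x \<in> carrier G \<Longrightarrow> y \<in> carrier G \<Longrightarrow> aug_prod x y \<in> frag.span B" "x \<in> carrier G"
  shows "frag_of (x [^] j) - frag_of \<one> - frag_cmul (int j) (frag_of x - frag_of \<one>) \<in> frag.span B"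
proof (induction j)
  case 0
  then show ?case by (simp add: frag.span_zero)
next
  case (Suc j)
  from frag.span_add[OF Suc assms(1)[of "x [^] j" x]] assms(2)
  show ?case by (simp add: aug_prod_def frag_cmul_distrib algebra_simps)
qed

lemma lattice_basis_aug_ideal_sq:
  assumes fin: "finite (carrier G)" and R: "R \<subseteq> carrier G \<times> carrier G" "card R < order G"
    and span: "\<And>x y. x \<in> carrier G \<Longrightarrow> y \<in> carrier G \<Longrightarrow>
      aug_prod x y \<in> frag.span (case_prod aug_prod ` R)"
  shows "lattice_basis (case_prod aug_prod ` R) (aug_ideal_sq G)"
proof -
  let ?B = "case_prod aug_prod ` R"
  have finR: "finite R" using R fin by (meson finite_SigmaI finite_subset)
  have BP: "?B \<subseteq> {aug_prod x y | x y. x \<in> carrier G \<and> y \<in> carrier G}" using R by auto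
  have PB: "{aug_prod x y | x y. x \<in> carrier G \<and> y \<in> carrier G} \<subseteq> frag.span ?B"
    using span by auto
  have eq: "frag.span ?B = aug_ideal_sq G"
    unfolding aug_ideal_sq_eq_span
    by (rule subset_antisym[OF frag.span_mono[OF BP] frag.span_minimal[OF PB frag.subspace_span]])
  \<comment> \<open>Together with \<open>\<one>\<close> the products number at most
    \<open>order G\<close>, and their span contains \<open>order G\<close> times every group
    element, so the rank count applies.\<close>
  have "frag.independent (insert (frag_of \<one>) ?B)"
  proof (rule frag_independent_if_card_le[where n = "int (order G)" and Z = "carrier G"])
    have "card (insert (frag_of \<one>) ?B) \<le> Suc (card ?B)"
      by (rule card_insert_le_m1) simp_all
    also have "\<dots> \<le> card (carrier G)"
      using R(2) card_image_le[OF finR, of "case_prod aug_prod"] by (simp only: order_def)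
    finally show "card (insert (frag_of \<one>) ?B) \<le> card (carrier G)" .
    show "int (order G) \<noteq> 0" 
      using fin order_gt_0_iff_finite by (metis of_nat_eq_0_iff less_irrefl)
    fix x assume x: "x \<in> carrier G"
    let ?S = "frag.span (insert (frag_of \<one>) ?B)"
    have "- frag_cmul (int (order G)) (frag_of x - frag_of \<one>) \<in> frag.span ?B"
      using pow_aug_in_span[OF span x, of "order G"]
      unfolding pow_order_eq_1[OF x] diff_self diff_0 .
    from frag.span_neg[OF this]
    have "frag_cmul (int (order G)) (frag_of x - frag_of \<one>) \<in> frag.span ?B"
      unfolding minus_minus .
    then have "frag_cmul (int (order G)) (frag_of x - frag_of \<one>) \<in> ?S"
      using frag.span_mono[OF subset_insertI] by (rule subsetD[rotated])
    moreover have "frag_cmul (int (order G)) (frag_of \<one>) \<in> ?S"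
      by (auto intro: frag.span_scale frag.span_base)
    ultimately have "frag_cmul (int (order G)) (frag_of x - frag_of \<one>)
        + frag_cmul (int (order G)) (frag_of \<one>) \<in> ?S" by (rule frag.span_add)
    then show "frag_cmul (int (order G)) (frag_of x) \<in> ?S"
      by (simp add: frag.scale_right_diff_distrib)
  qed (use fin finR in auto)
  then have "frag.independent ?B" by (rule frag.independent_mono) auto
  with eq show ?thesis by (simp add: lattice_basis_def)
qed

section \<open>Adjoining one element to a subgroup\<close>

definition adjoin :: "'a set \<Rightarrow> 'a \<Rightarrow> 'a set"
  where "adjoin H g = (\<lambda>(h, i::nat). h \<otimes> g [^] i) ` (H \<times> UNIV)"

text \<open>
  Pairs with second component \<open>\<one>\<close> are excluded because the step from \<open>(h, h')\<close> to \<open>(h \<otimes> g, h')\<close>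
  yields length 2 only for \<open>h' \<noteq> \<one>\<close>.
\<close>

definition generating_pairs :: "'a set \<Rightarrow> ('a \<times> 'a) set \<Rightarrow> bool"
  where "generating_pairs H R \<longleftrightarrow> R \<subseteq> H \<times> (H - {\<one>}) \<and> card R < card H \<and>
    (\<forall>x\<in>H. \<forall>y\<in>H. aug_prod x y \<in> frag.span (case_prod aug_prod ` R))"

lemma adjoinI: "h \<in> H \<Longrightarrow> h \<otimes> g [^] (i::nat) \<in> adjoin H g"
  by (force simp: adjoin_def)

lemma adjoinE:
  assumes "x \<in> adjoin H g"
  obtains h and i :: nat where "h \<in> H" "x = h \<otimes> g [^] i"
  using assms by (auto simp: adjoin_def)

text \<open>In a finite group the natural powers of \<open>g\<close> already form the subgroup
  generated by \<open>g\<close>, so \<open>adjoin H g\<close> is a product of two subgroups.\<close>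

lemma subgroup_adjoin:
  assumes "finite (carrier G)" "subgroup H G" "g \<in> carrier G"
  shows "subgroup (adjoin H g) G"
proof -
  have "generate G {g} = {g [^] k | k. k \<in> (UNIV :: nat set)}"
    using assms ord_ge_1[of g] by (intro generate_pow_nat) auto
  then have "adjoin H g = H <#> generate G {g}"
    by (auto simp: adjoin_def set_mult_def)
  then show ?thesis
    using mult_subgroups[OF assms(2) generate_is_subgroup[of "{g}"]] assms(3) by simp
qed

text \<open>With \<open>E x = x - 1\<close> modulo the span, \<open>E (g^i) = i E g\<close> is shown
  for \<open>i \<le> m\<close>, then \<open>E (h g^j) = E h + j E g\<close> for all
  \<open>j\<close>. As \<open>E\<close> is additive on \<open>H\<close>, this formula makes it
  additive on \<open>adjoin H g\<close>.\<close>

lemma aug_prod_adjoin_in_span: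
  assumes H: "subgroup H G" and g: "g \<in> carrier G" and m: "0 < m" "g [^] (m::nat) \<in> H" and k: "k \<in> H"
    and HH: "\<And>x y. x \<in> H \<Longrightarrow> y \<in> H \<Longrightarrow> aug_prod x y \<in> frag.span B"
    and Hg: "\<And>h i. h \<in> H \<Longrightarrow> 0 < i \<Longrightarrow> i < m \<Longrightarrow> aug_prod h (g [^] i) \<in> frag.span B"
    and kg: "\<And>i. 0 < i \<Longrightarrow> i < m \<Longrightarrow> aug_prod (k \<otimes> g [^] i) g \<in> frag.span B"
    and x: "x \<in> adjoin H g" and y: "y \<in> adjoin H g"
  shows "aug_prod x y \<in> frag.span B"
proof -
  define E where "E x = frag_of x - frag_of \<one>" for x
  have D: "aug_prod x y = E (x \<otimes> y) - E x - E y" for x y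
    by (simp add: aug_prod_def E_def)
  have HG: "h \<in> carrier G" if "h \<in> H" for h
    using subgroup.mem_carrier[OF H that] .
  have Hg': "aug_prod h (g [^] i) \<in> frag.span B" if "h \<in> H" "i \<le> m" for h i
    \<comment> \<open>The boundary exponents are free: \<open>i = 0\<close> gives the zero product,
      and for \<open>i = m\<close> both factors lie in \<open>H\<close>.\<close>
    using Hg[of h i] HH[OF _ m(2), of h] that HG[of h]
    by (cases "i = 0"; cases "i = m") (auto simp: frag.span_zero)
  have powers: "E (g [^] i) - frag_cmul (int i) (E g) \<in> frag.span B" if "i \<le> m" for i
    using that
  proof (induction i)
    case 0
    then show ?case by (simp add: E_def frag.span_zero)
  next
    case (Suc i)
    show ?case
    proof (cases "i = 0")
      case True
      then show ?thesis using g by (simp add: frag.span_zero)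
    next
      case False
      \<comment> \<open>The passage from \<open>g^i\<close> to \<open>g^(i+1)\<close> is made after
        multiplication by \<open>k\<close>. The two products with first factor \<open>k\<close>
        insert and remove this factor.\<close>
      have "E (g [^] Suc i) - frag_cmul (int (Suc i)) (E g) =
          (E (g [^] i) - frag_cmul (int i) (E g)) + aug_prod (k \<otimes> g [^] i) g
          + aug_prod k (g [^] i) - aug_prod k (g [^] Suc i)"
        using g HG[OF k] by (simp add: D m_assoc frag_cmul_distrib algebra_simps)
      also have "\<dots> \<in> frag.span B"

        by (rule frag.span_diff[OF frag.span_add[OF frag.span_add[OF Suc.IH kg] Hg'[OF k]] Hg'[OF k]])
          (use Suc.prems False in auto)
      finally show ?thesis .
    qed
  qed
  have mixed: "E (h \<otimes> g [^] j) - E h - frag_cmul (int j) (E g) \<in> frag.span B" if "h \<in> H" for h j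
    using that
  proof (induction j arbitrary: h rule: less_induct)
    case (less j)
    have small: "E (h \<otimes> g [^] i) - E h - frag_cmul (int i) (E g) \<in> frag.span B" if "i \<le> m" for i
      using frag.span_add[OF Hg'[OF less.prems that] powers[OF that]] by (simp add: D algebra_simps)
    show ?case
    proof (cases "j \<le> m")
      case True
      then show ?thesis by (rule small)
    next
      case False
      \<comment> \<open>A factor \<open>g^m\<close> is absorbed into \<open>H\<close>, which lowers
        the exponent; hence the induction keeps \<open>h\<close> arbitrary.\<close>
      have hm: "h \<otimes> g [^] m \<in> H" using subgroup.m_closed[OF H less.prems m(2)] .
      have "h \<otimes> g [^] j = (h \<otimes> g [^] m) \<otimes> g [^] (j - m)"
        using False g HG[OF less.prems] by (simp add: m_assoc nat_pow_mult)
      moreover have "frag_cmul (int j) (E g) = frag_cmul (int m) (E g) + frag_cmul (int (j - m)) (E g)"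
        using False by (simp add: frag_cmul_distrib[symmetric])
      ultimately show ?thesis
        using frag.span_add[OF less.IH[OF _ hm, of "j - m"] small[of m]] False m(1)
        by (simp add: algebra_simps)
    qed
  qed
  obtain h i where x': "h \<in> H" "x = h \<otimes> g [^] (i::nat)" using x by (rule adjoinE)
  obtain h' j where y': "h' \<in> H" "y = h' \<otimes> g [^] (j::nat)" using y by (rule adjoinE)
  have "x \<otimes> y = (h \<otimes> h') \<otimes> g [^] (i + j)"
    using x' y' g HG by (simp add: m_ac nat_pow_mult[symmetric])
  then have "aug_prod x y = (E ((h \<otimes> h') \<otimes> g [^] (i + j)) - E (h \<otimes> h') - frag_cmul (int (i + j)) (E g))
      - (E x - E h - frag_cmul (int i) (E g)) - (E y - E h' - frag_cmul (int j) (E g)) + aug_prod h h'"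
    by (simp add: D frag_cmul_distrib algebra_simps)
  also have "\<dots> \<in> frag.span B"
    using frag.span_add[OF frag.span_diff[OF frag.span_diff[OF
            mixed[OF subgroup.m_closed[OF H x'(1) y'(1)], of "i + j"]
            mixed[OF x'(1), of i]] mixed[OF y'(1), of j]] HH[OF x'(1) y'(1)]]
    unfolding x'(2)[symmetric] y'(2)[symmetric] .
  finally show ?thesis .
qed

definition adjoin_pairs :: "('a \<times> 'a) set \<Rightarrow> 'a set \<Rightarrow> 'a \<Rightarrow> 'a \<Rightarrow> nat \<Rightarrow> ('a \<times> 'a) set"
  where "adjoin_pairs R H g k m = (\<lambda>(h, h'). (h \<otimes> g, h')) ` R
    \<union> (H - {\<one>}) \<times> (\<lambda>i. g [^] i) ` {0<..<m} \<union> (\<lambda>i. (k \<otimes> g [^] i, g)) ` {0<..<m}"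

end

section \<open>Counting and lengths in a cyclic extension\<close>

locale cyclic_extension = comm_group G for G (structure) +
  fixes H g and m :: nat
  assumes finite_carrier: "finite (carrier G)"
    and subgroup_H: "subgroup H G" and g_closed [simp]: "g \<in> carrier G"
    and m_pos: "0 < m" and pow_m: "g [^] m \<in> H"
    and pow_less: "\<And>i. 0 < i \<Longrightarrow> i < m \<Longrightarrow> g [^] i \<notin> H"
begin

lemma H_closed [simp]: "h \<in> H \<Longrightarrow> h \<in> carrier G"
  using subgroup.mem_carrier[OF subgroup_H] .

lemma finite_H: "finite H"
  using finite_carrier finite_subset[OF subgroup.subset[OF subgroup_H]] by blast

lemma one_H: "\<one> \<in> H"
  using subgroup.one_closed[OF subgroup_H] .

lemma mult_H: "h \<in> H \<Longrightarrow> h' \<in> H \<Longrightarrow> h \<otimes> h' \<in> H"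
  using subgroup.m_closed[OF subgroup_H] .

lemma mult_in_H_iff:
  assumes "h \<in> H" "x \<in> carrier G"
  shows "h \<otimes> x \<in> H \<longleftrightarrow> x \<in> H"
proof
  assume "h \<otimes> x \<in> H"
  from mult_H[OF subgroup.m_inv_closed[OF subgroup_H assms(1)] this] show "x \<in> H"
    using assms by (simp add: m_assoc[symmetric])
qed (use assms mult_H in auto)

lemma pow_cancel:
  assumes eq: "h \<otimes> g [^] i = h' \<otimes> g [^] j" and h: "h \<in> H" "h' \<in> H" and ij: "i \<le> j" "j < m"
  shows "h = h' \<and> i = j"
proof -
  have "h \<otimes> g [^] i = (h' \<otimes> g [^] (j - i)) \<otimes> g [^] i"
    using eq h ij by (simp add: m_assoc nat_pow_mult)
  then have *: "h = h' \<otimes> g [^] (j - i)"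
    using h by simp
  then have "g [^] (j - i) \<in> H"
    using h mult_in_H_iff by (metis g_closed nat_pow_closed)
  then have "i = j"
    using pow_less[of "j - i"] ij by fastforce
  then show ?thesis using * h by simp
qed

text \<open>The cosets of \<open>H\<close> by \<open>g^i\<close>, \<open>i < m\<close>, are distinct
  because \<open>m\<close> is minimal. This bounds the size of \<open>adjoin H g\<close> from below
  and, for trivial \<open>H\<close>, separates the powers of \<open>g\<close>.\<close>

lemma inj_on_mult_pow: "inj_on (\<lambda>(h, i). h \<otimes> g [^] i) (H \<times> {..<m})"
proof (clarsimp simp: inj_on_def)
  fix h i h' j
  assume "h \<in> H" "i < m" "h' \<in> H" "j < m" "h \<otimes> g [^] i = h' \<otimes> g [^] j"
  then show "h = h' \<and> i = j"
    using pow_cancel[of h i h' j] pow_cancel[of h' j h i] by (cases "i \<le> j") auto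
qed

lemma finite_adjoin: "finite (adjoin H g)"
  using subgroup.subset[OF subgroup_adjoin[OF finite_carrier subgroup_H g_closed]] finite_carrier
  by (rule finite_subset)

lemma card_adjoin: "card H * m \<le> card (adjoin H g)"
proof -
  have "card H * m = card ((\<lambda>(h, i). h \<otimes> g [^] i) ` (H \<times> {..<m}))"
    by (simp add: card_image[OF inj_on_mult_pow] card_cartesian_product)
  also have "\<dots> \<le> card (adjoin H g)"
    by (rule card_mono[OF finite_adjoin]) (auto simp: adjoin_def)
  finally show ?thesis .
qed

lemma generating_pairs_adjoin:
  assumes R: "generating_pairs H R" and k: "k \<in> H" and g: "g \<notin> H"
  shows "generating_pairs (adjoin H g) (adjoin_pairs R H g k m)"
proof -
  let ?R = "adjoin_pairs R H g k m"
  let ?B = "case_prod aug_prod ` ?R"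
  have R': "R \<subseteq> H \<times> (H - {\<one>})" "card R < card H"
    "\<And>x y. x \<in> H \<Longrightarrow> y \<in> H \<Longrightarrow> aug_prod x y \<in> frag.span (case_prod aug_prod ` R)"
    using R by (auto simp: generating_pairs_def)
  have finR: "finite R" using R'(1) finite_H by (meson finite_Diff finite_SigmaI finite_subset)
  have HA: "h \<in> adjoin H g" if "h \<in> H" for h
    using adjoinI[OF that, of g 0] that by simp
  have gA: "g [^] i \<in> adjoin H g" for i :: nat
    using adjoinI[OF one_H, of g i] by simp
  have gA1: "g \<in> adjoin H g" using gA[of 1] by simp
  have hgA: "h \<otimes> g \<in> adjoin H g" if "h \<in> H" for h
    using adjoinI[OF that, of g 1] by simp
  have g1: "g \<noteq> \<one>" using g one_H by auto
  have gi1: "g [^] i \<noteq> \<one>" if "0 < i" "i < m" for i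
    using pow_less[OF that] one_H by auto
  have sub: "?R \<subseteq> adjoin H g \<times> (adjoin H g - {\<one>})"
    unfolding adjoin_pairs_def
  proof (intro Un_least)
    show "(\<lambda>(h, h'). (h \<otimes> g, h')) ` R \<subseteq> adjoin H g \<times> (adjoin H g - {\<one>})"
      using R'(1) HA hgA by auto
    show "(H - {\<one>}) \<times> (\<lambda>i. g [^] i) ` {0<..<m} \<subseteq> adjoin H g \<times> (adjoin H g - {\<one>})"
      using HA gA gi1 by auto
    show "(\<lambda>i. (k \<otimes> g [^] i, g)) ` {0<..<m} \<subseteq> adjoin H g \<times> (adjoin H g - {\<one>})"
      using adjoinI[OF k] gA1 g1 by auto
  qed
  \<comment> \<open>The three families contribute at most \<open>card H - 1\<close>,
    \<open>(card H - 1) (m - 1)\<close> and \<open>m - 1\<close> pairs, in total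
    \<open>card H * m - 1\<close>.\<close>
  have "card ?R \<le> card ((\<lambda>(h, h'). (h \<otimes> g, h')) ` R \<union> (H - {\<one>}) \<times> (\<lambda>i. g [^] i) ` {0<..<m})
      + card ((\<lambda>i. (k \<otimes> g [^] i, g)) ` {0<..<m})"
    unfolding adjoin_pairs_def by (rule card_Un_le)
  also have "\<dots> \<le> card ((\<lambda>(h, h'). (h \<otimes> g, h')) ` R) + card ((H - {\<one>}) \<times> (\<lambda>i. g [^] i) ` {0<..<m})
      + card ((\<lambda>i. (k \<otimes> g [^] i, g)) ` {0<..<m})"
    by (intro add_mono card_Un_le order_refl)
  also have "\<dots> \<le> card R + card (H - {\<one>}) * (m - 1) + (m - 1)"
    unfolding card_cartesian_product
    by (intro add_mono mult_mono card_image_le[OF finR] order_refl order.trans[OF card_image_le]) auto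
  also have "\<dots> < card H + card (H - {\<one>}) * (m - 1) + (m - 1)"
    using R'(2) by simp
  also have "\<dots> = card H * m"
  proof -
    obtain c where c: "card H = Suc c" using R'(2) by (cases "card H") auto
    obtain n where n: "m = Suc n" using m_pos by (cases m) auto
    show ?thesis using c n one_H finite_H by (simp add: algebra_simps)
  qed
  also have "\<dots> \<le> card (adjoin H g)" by (rule card_adjoin)
  finally have card: "card ?R < card (adjoin H g)" .
  have B: "aug_prod x y \<in> frag.span ?B" if "(x, y) \<in> ?R" for x y
    using that by (force intro: frag.span_base)
  have m2: "1 < m" using g pow_m m_pos by (cases "m = 1") auto
  have Hg: "aug_prod h (g [^] i) \<in> frag.span ?B" if "h \<in> H" "0 < i" "i < m" for h i
  proof (cases "h = \<one>")
    case True
    then show ?thesis by (simp add: frag.span_zero)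
  next
    case False
    show ?thesis by (rule B) (use that False in \<open>auto simp: adjoin_pairs_def\<close>)
  qed
  have R_B: "aug_prod h h' \<in> frag.span ?B" if "(h, h') \<in> R" for h h'
  proof -
    have hh: "h \<in> H" "h' \<in> H" using that R'(1) by auto
    \<comment> \<open>The shifted product yields the original one up to products of elements of
      \<open>H\<close> with \<open>g\<close>. The latter belong to the second family, since
      \<open>g \<notin> H\<close> forces \<open>1 < m\<close>; the exponent 1 is written out to
      match that family.\<close>
    have "aug_prod h h' = aug_prod (h \<otimes> g) h' - aug_prod (h \<otimes> h') (g [^] (1::nat)) + aug_prod h (g [^] (1::nat))"
    proof -
      have "h \<otimes> g \<otimes> h' = h \<otimes> h' \<otimes> g" using hh by (simp add: m_ac)
      then show ?thesis by (simp add: aug_prod_def)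
    qed
    also have "\<dots> \<in> frag.span ?B"
      by (rule frag.span_add[OF frag.span_diff[OF B Hg] Hg])
        (use that hh m2 in \<open>auto simp: adjoin_pairs_def mult_H\<close>)
    finally show ?thesis .
  qed
  have "case_prod aug_prod ` R \<subseteq> frag.span ?B" using R_B by auto
  from frag.span_minimal[OF this frag.subspace_span]
  have HH: "aug_prod x y \<in> frag.span ?B" if "x \<in> H" "y \<in> H" for x y
    using R'(3)[OF that] by (rule subsetD)
  have kg: "aug_prod (k \<otimes> g [^] i) g \<in> frag.span ?B" if "0 < i" "i < m" for i
    by (rule B) (use that in \<open>auto simp: adjoin_pairs_def\<close>)
  show ?thesis
    unfolding generating_pairs_def
    using sub card aug_prod_adjoin_in_span[OF subgroup_H g_closed m_pos pow_m k HH Hg kg] by blast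
qed

lemma group_ring_length_aug_prod_outside:
  assumes "x \<in> carrier G" "y \<in> carrier G" "x \<noteq> \<one>" "y \<noteq> \<one>" "x \<in> H \<longleftrightarrow> y \<notin> H" "x \<otimes> y \<notin> H"
  shows "group_ring_length (aug_prod x y) = 2"
proof (rule group_ring_length_aug_prod)
  show "x \<noteq> y" using assms(5) by blast
  show "x \<otimes> y \<noteq> \<one>" using assms(6) one_H by metis
qed (fact assms)+

text \<open>In the first two families exactly one factor lies in \<open>H\<close>. In the third
  neither does: \<open>k \<noteq> \<one>\<close> separates \<open>k g^i\<close> from
  \<open>g\<close>, and the product \<open>k g^(i+1)\<close> is outside \<open>H\<close> except for
  \<open>i = m - 1\<close>, where it is \<open>k g^m \<noteq> \<one>\<close>.\<close>

lemma length_adjoin_pairs: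
  assumes R: "R \<subseteq> H \<times> (H - {\<one>})" and k: "k \<in> H" "k \<noteq> \<one>" "k \<otimes> g [^] m \<noteq> \<one>" and g: "g \<notin> H"
    and xy: "(x, y) \<in> adjoin_pairs R H g k m"
  shows "group_ring_length (aug_prod x y) = 2"
proof -
  have nH: "h \<otimes> g [^] i \<notin> H" if "h \<in> H" "0 < i" "i < m" for h i
    using pow_less that by (simp add: mult_in_H_iff)
  consider h h' where "(h, h') \<in> R" "x = h \<otimes> g" "y = h'"
    | i where "x \<in> H" "x \<noteq> \<one>" "0 < i" "i < m" "y = g [^] i"
    | i where "0 < i" "i < m" "x = k \<otimes> g [^] i" "y = g"
    using xy unfolding adjoin_pairs_def by (elim UnE) auto
  then show ?thesis
  proof cases
    case 1
    then have h: "h \<in> H" "h' \<in> H" "h' \<noteq> \<one>" using R by auto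
    have hg: "h \<otimes> g \<notin> H" using h g by (simp add: mult_in_H_iff)
    have "h \<otimes> g \<otimes> h' = h \<otimes> h' \<otimes> g"
      using h by (simp add: m_ac)
    then have "h \<otimes> g \<otimes> h' \<notin> H"
      using g mult_in_H_iff[OF mult_H[OF h(1,2)] g_closed] by simp
    moreover have "h \<otimes> g \<noteq> \<one>" using hg one_H by metis
    ultimately show ?thesis
      unfolding 1(2,3) using h hg by (intro group_ring_length_aug_prod_outside) simp_all
  next
    case 2
    have "y \<notin> H" "x \<otimes> y \<notin> H" "y \<in> carrier G"
      unfolding 2(5) using pow_less[OF 2(3,4)] nH[OF 2(1,3,4)] by simp_all
    moreover from this have "y \<noteq> \<one>" using one_H by metis
    ultimately show ?thesis
      using 2(1,2) by (intro group_ring_length_aug_prod_outside) simp_all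
  next
    case 3
    have "x \<noteq> g"
    proof
      assume "x = g"
      then have "\<one> \<otimes> g [^] (1::nat) = k \<otimes> g [^] i" unfolding 3(3) by simp
      from pow_cancel[OF this one_H k(1)] show False using 3(1,2) k(2) by simp
    qed
    moreover have "x \<otimes> g \<noteq> \<one>"
    proof -
      have "x \<otimes> g = k \<otimes> g [^] Suc i" unfolding 3(3) using k(1) by (simp add: m_assoc)
      moreover have "k \<otimes> g [^] Suc i \<noteq> \<one>"
        using k(3) nH[OF k(1), of "Suc i"] 3(2) one_H by (cases "Suc i = m") auto
      ultimately show ?thesis by simp
    qed
    moreover have "x \<noteq> \<one>" unfolding 3(3) using nH[OF k(1) 3(1,2)] one_H by metis
    moreover have "g \<noteq> \<one>" using g one_H by metis
    moreover have "x \<in> carrier G" unfolding 3(3) using k(1) by simp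
    ultimately show ?thesis unfolding 3(4) by (intro group_ring_length_aug_prod g_closed)
  qed
qed

section \<open>Cyclic groups of order at least 5\<close>

definition cyclic_pairs :: "('a \<times> 'a) set"
  where "cyclic_pairs = (\<lambda>i. (g [^] i, g)) ` {2..m - 2}
    \<union> {(g [^] (m - 1), g [^] (2::nat)), (g [^] (m - 1), g [^] (3::nat))}"

text \<open>For trivial \<open>H\<close> the general step would use \<open>(g^i, g)\<close> with
  \<open>0 < i < m\<close>, but for \<open>i = 1\<close> and \<open>i = m - 1\<close> the products
  have length \<open>sqrt 6\<close>. These two are replaced by the last two members of
  \<open>cyclic_pairs\<close>, from which they are recovered here: first \<open>i = m - 1\<close>,
  then \<open>i = 1\<close>.\<close>

lemma aug_prod_cyclic_in_span:
  assumes H: "H = {\<one>}" and m: "5 \<le> m" and x: "x \<in> adjoin H g" and y: "y \<in> adjoin H g"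
  shows "aug_prod x y \<in> frag.span (case_prod aug_prod ` cyclic_pairs)"
proof -
  let ?B = "case_prod aug_prod ` cyclic_pairs"
  have B: "aug_prod x y \<in> frag.span ?B" if "(x, y) \<in> cyclic_pairs" for x y
    using that by (force intro: frag.span_base)
  have gm: "g [^] m = \<one>" using pow_m H by simp
  define n where "n = m - 1"
  have n: "m = Suc n" using m by (simp add: n_def)
  have pow_Suc: "g [^] n \<otimes> g = \<one>" using gm n by simp
  have pow_2: "g [^] n \<otimes> g [^] (2::nat) = g"
    using gm n nat_pow_mult[of g n 2] nat_pow_mult[of g "Suc n" 1] by simp
  have pow_3: "g [^] n \<otimes> g [^] (3::nat) = g [^] (2::nat)"
    using gm n nat_pow_mult[of g n 3] nat_pow_mult[of g "Suc n" 2] by (simp add: numeral_eq_Suc)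
  have g3: "g [^] (2::nat) \<otimes> g = g [^] (3::nat)"
    by (simp add: numeral_eq_Suc)
  have B2: "aug_prod (g [^] (2::nat)) g \<in> frag.span ?B"
    by (rule B) (use m in \<open>force simp: cyclic_pairs_def\<close>)
  have Bn2: "aug_prod (g [^] n) (g [^] (2::nat)) \<in> frag.span ?B"
    and Bn3: "aug_prod (g [^] n) (g [^] (3::nat)) \<in> frag.span ?B"
    by (rule B, simp add: cyclic_pairs_def n_def)+
  have Bn: "aug_prod (g [^] n) g \<in> frag.span ?B"
  proof -
    have "aug_prod (g [^] n) g = aug_prod (g [^] n) (g [^] (3::nat)) + aug_prod (g [^] (2::nat)) g"
      by (simp add: aug_prod_def pow_Suc pow_3 g3)
    then show ?thesis using frag.span_add[OF Bn3 B2] by simp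
  qed
  have B1: "aug_prod g g \<in> frag.span ?B"
  proof -
    have "g \<otimes> g = g [^] (2::nat)" by (simp add: numeral_eq_Suc)
    then have "aug_prod g g = aug_prod (g [^] n) g - aug_prod (g [^] n) (g [^] (2::nat))"
      by (simp add: aug_prod_def pow_Suc pow_2)
    then show ?thesis using frag.span_diff[OF Bn Bn2] by simp
  qed
  have kg: "aug_prod (\<one> \<otimes> g [^] i) g \<in> frag.span ?B" if "0 < i" "i < m" for i
  proof -
    have "i = 1 \<or> i = n \<or> 2 \<le> i \<and> i \<le> m - 2" using that n by linarith
    then consider "i = 1" | "i = n" | "2 \<le> i" "i \<le> m - 2" by blast
    then show ?thesis
    proof cases
      case 3
      then show ?thesis by (intro B) (auto simp: cyclic_pairs_def)
    qed (use B1 Bn in auto)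
  qed
  show ?thesis
    by (rule aug_prod_adjoin_in_span[OF subgroup_H g_closed m_pos pow_m one_H _ _ kg x y])
      (use H in \<open>auto simp: frag.span_zero\<close>)
qed

lemma card_cyclic_pairs:
  assumes "5 \<le> m"
  shows "card cyclic_pairs < m"
proof -
  have "card cyclic_pairs \<le> card ((\<lambda>i. (g [^] i, g)) ` {2..m - 2})
      + card {(g [^] (m - 1), g [^] (2::nat)), (g [^] (m - 1), g [^] (3::nat))}"
    unfolding cyclic_pairs_def by (rule card_Un_le)
  also have "\<dots> \<le> (m - 3) + 2"
    using assms by (intro add_mono order.trans[OF card_image_le] order.trans[OF card_insert_le_m1]) auto
  also have "\<dots> < m" using assms by simp
  finally show ?thesis .
qed

text \<open>Two powers with exponents strictly between 0 and \<open>m\<close> give length 2 unless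
  the exponents agree or add up to \<open>m\<close>. The bound \<open>5 \<le> m\<close> keeps
  \<open>m - 1\<close> apart from 3.\<close>

lemma length_cyclic_pairs:
  assumes H: "H = {\<one>}" and m: "5 \<le> m" and xy: "(x, y) \<in> cyclic_pairs"
  shows "group_ring_length (aug_prod x y) = 2"
proof -
  have inj: "g [^] i = g [^] j \<longleftrightarrow> i = j" if "i < m" "j < m" for i j
    using inj_onD[OF inj_on_mult_pow, of "(\<one>, i)" "(\<one>, j)"] that H by auto
  have mod: "g [^] i = g [^] (i - m)" if "m \<le> i" for i
    using pow_m H nat_pow_mult[of g m "i - m"] that by simp
  have len: "group_ring_length (aug_prod (g [^] i) (g [^] j)) = 2"
    if "0 < i" "i < m" "0 < j" "j < m" "i \<noteq> j" "i + j \<noteq> m" for i j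
  proof (rule group_ring_length_aug_prod)
    show "g [^] i \<noteq> \<one>" "g [^] j \<noteq> \<one>" "g [^] i \<noteq> g [^] j"
      using inj[of i 0] inj[of j 0] inj[of i j] that by auto
    show "g [^] i \<otimes> g [^] j \<noteq> \<one>"
      using inj[of "i + j" 0] inj[of "i + j - m" 0] mod[of "i + j"] that
      by (cases "i + j < m") (auto simp: nat_pow_mult)
  qed simp_all
  consider i where "2 \<le> i" "i \<le> m - 2" "x = g [^] i" "y = g [^] (1::nat)"
    | "x = g [^] (m - 1)" "y = g [^] (2::nat)" | "x = g [^] (m - 1)" "y = g [^] (3::nat)"
    using xy by (auto simp: cyclic_pairs_def)
  then show ?thesis
  proof cases
    case 1
    show ?thesis unfolding 1(3,4) by (rule len) (use 1(1,2) m in auto)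
  qed (use m in \<open>auto intro!: len\<close>)
qed

end

section \<open>Reaching the whole group\<close>

context comm_group
begin

lemma cyclic_extension_Least:
  assumes "finite (carrier G)" "subgroup H G" "g \<in> carrier G"
  shows "cyclic_extension G H g (LEAST m::nat. 0 < m \<and> g [^] m \<in> H)"
proof -
  define P where "P m \<longleftrightarrow> 0 < m \<and> g [^] m \<in> H" for m :: nat
  have "0 < order G" using assms(1) order_gt_0_iff_finite by blast
  moreover have "g [^] order G \<in> H"
    unfolding pow_order_eq_1[OF assms(3)] by (rule subgroup.one_closed[OF assms(2)])
  ultimately have "P (order G)" by (simp only: P_def)
  then have "P (LEAST m. P m)" by (rule LeastI)
  then have least: "0 < (LEAST m. P m)" "g [^] (LEAST m. P m) \<in> H" by (simp_all only: P_def)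
  have minimal: "g [^] i \<notin> H" if "0 < i" "i < (LEAST m. P m)" for i
    using not_less_Least[OF that(2)] that(1) unfolding P_def by blast
  have "cyclic_extension G H g (LEAST m. P m)"
    by (intro cyclic_extension.intro comm_group_axioms cyclic_extension_axioms.intro assms least minimal)
  then show ?thesis by (simp only: P_def)
qed

text \<open>Among the proper subgroups with generating pairs one of greatest size is taken.
  Adjoining any outside element gives a larger subgroup with generating pairs, so it must be all of
  \<open>G\<close>. This form of the induction exposes its last step, the only one that matters for
  the lengths.\<close>

lemma exists_maximal_extension:
  assumes fin: "finite (carrier G)" and nontriv: "carrier G \<noteq> {\<one>}"
  obtains H g m R where "cyclic_extension G H g m" "g \<notin> H" "generating_pairs H R"
    "adjoin H g = carrier G"
proof -
  define P where "P H \<longleftrightarrow> subgroup H G \<and> H \<noteq> carrier G \<and> (\<exists>R. generating_pairs H R)" for H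
  have "generating_pairs {\<one>} {}"
    by (simp add: generating_pairs_def frag.span_zero)
  then have "P {\<one>}"
    using nontriv triv_subgroup by (auto simp: P_def)
  moreover have bound: "card H \<le> order G" if "P H" for H
    using that fin card_mono[OF fin subgroup.subset] by (simp add: P_def order_def)
  ultimately obtain H where H: "P H" and max: "\<And>K. P K \<Longrightarrow> card K \<le> card H"
    using ex_has_greatest_nat[of P "{\<one>}" card "Suc (order G)"] le_imp_less_Suc by blast
  then have sub: "subgroup H G" and "H \<noteq> carrier G" by (auto simp: P_def)
  then obtain g where g: "g \<in> carrier G" "g \<notin> H"
    using subgroup.subset[OF sub] by blast
  obtain R where R: "generating_pairs H R" using H by (auto simp: P_def)
  define m where "m = (LEAST m::nat. 0 < m \<and> g [^] m \<in> H)"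
  interpret cyclic_extension G H g m
    unfolding m_def by (rule cyclic_extension_Least[OF fin sub g(1)])
  have "m \<noteq> 1" using pow_m g by auto
  then have "2 \<le> m" using m_pos by simp
  have "card H < card H * 2" using one_H finite_H card_gt_0_iff by fastforce
  also have "\<dots> \<le> card H * m" using \<open>2 \<le> m\<close> by simp
  also have "\<dots> \<le> card (adjoin H g)" by (rule card_adjoin)
  finally have "\<not> P (adjoin H g)" using max leD by blast
  then have "adjoin H g = carrier G"
    using generating_pairs_adjoin[OF R one_H g(2)] subgroup_adjoin[OF fin sub g(1)]
    by (auto simp: P_def)
  with that[OF cyclic_extension_axioms g(2) R] show ?thesis by blast
qed

lemma generating_pairs_lattice_basis:
  assumes "finite (carrier G)" "generating_pairs (carrier G) R"
  shows "lattice_basis (case_prod aug_prod ` R) (aug_ideal_sq G)"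
  using assms by (intro lattice_basis_aug_ideal_sq) (auto simp: generating_pairs_def order_def)

lemma exists_product_basis:
  assumes fin: "finite (carrier G)"
  shows "\<exists>R \<subseteq> carrier G \<times> carrier G. lattice_basis (case_prod aug_prod ` R) (aug_ideal_sq G)"
proof -
  have "\<exists>R. generating_pairs (carrier G) R"
  proof (cases "carrier G = {\<one>}")
    case True
    then have "generating_pairs (carrier G) {}"
      by (simp add: generating_pairs_def frag.span_zero)
    then show ?thesis ..
  next
    case False
    then obtain H g m R where ext: "cyclic_extension G H g m" and H: "g \<notin> H" "generating_pairs H R"
      "adjoin H g = carrier G" using exists_maximal_extension[OF fin] by metis
    interpret cyclic_extension G H g m by (rule ext)
    show ?thesis using generating_pairs_adjoin[OF H(2) one_H H(1)] H(3) by auto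
  qed
  then obtain R where R: "generating_pairs (carrier G) R" ..
  then have "R \<subseteq> carrier G \<times> carrier G" by (auto simp: generating_pairs_def)
  then show ?thesis using generating_pairs_lattice_basis[OF fin R] by blast
qed

lemma cyclic_length_2_basis:
  assumes fin: "finite (carrier G)" and g: "g \<in> carrier G"
    and gen: "carrier G \<subseteq> range (\<lambda>i::nat. g [^] i)" and order: "4 < order G"
  shows "\<exists>B. lattice_basis B (aug_ideal_sq G) \<and> (\<forall>x\<in>B. group_ring_length x = 2)"
proof -
  define m where "m = (LEAST m::nat. 0 < m \<and> g [^] m \<in> {\<one>})"
  interpret cyclic_extension G "{\<one>}" g m
    unfolding m_def by (rule cyclic_extension_Least[OF fin triv_subgroup g])
  have gm: "g [^] m = \<one>" using pow_m by simp
  \<comment> \<open>Here \<open>m\<close> is the order of \<open>g\<close>. Reducing exponents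
    modulo \<open>m\<close> shows that \<open>order G \<le> m\<close>, which carries the bound on
    the order over to \<open>m\<close>.\<close>
  have "carrier G \<subseteq> (\<lambda>i. g [^] i) ` {..<m}"
  proof
    fix x assume "x \<in> carrier G"
    then obtain i :: nat where x: "x = g [^] i" using gen by auto
    have "g [^] i = g [^] (m * (i div m) + i mod m)" by simp
    also have "\<dots> = (g [^] m) [^] (i div m) \<otimes> g [^] (i mod m)"
      by (simp only: nat_pow_mult[symmetric] nat_pow_pow g_closed)
    also have "\<dots> = g [^] (i mod m)" by (simp add: gm)
    finally show "x \<in> (\<lambda>i. g [^] i) ` {..<m}" using x m_pos by auto
  qed
  from card_mono[OF _ this] have "order G \<le> card ((\<lambda>i. g [^] i) ` {..<m})"
    by (simp add: order_def)
  also have "\<dots> \<le> m" using card_image_le[of "{..<m}"] by fastforce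
  finally have "order G \<le> m" .
  then have m: "5 \<le> m" using order by simp
  have adj: "x \<in> adjoin {\<one>} g" if "x \<in> carrier G" for x
    using that gen adjoinI[of \<one> "{\<one>}" g] by auto
  have "card (adjoin {\<one>} g) \<le> order G"
    unfolding order_def
    by (rule card_mono[OF fin subgroup.subset[OF subgroup_adjoin[OF fin triv_subgroup g]]])
  then have "card cyclic_pairs < order G"
    using card_cyclic_pairs[OF m] card_adjoin by simp
  moreover have "cyclic_pairs \<subseteq> carrier G \<times> carrier G"
    by (auto simp: cyclic_pairs_def)
  ultimately have "lattice_basis (case_prod aug_prod ` cyclic_pairs) (aug_ideal_sq G)"
    using aug_prod_cyclic_in_span[OF refl m adj adj] by (intro lattice_basis_aug_ideal_sq[OF fin])
  moreover have "\<forall>x\<in>case_prod aug_prod ` cyclic_pairs. group_ring_length x = 2"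
    using length_cyclic_pairs[OF refl m] by auto
  ultimately show ?thesis by blast
qed

text \<open>The last step needs \<open>k \<in> H\<close> different from \<open>\<one>\<close> and
  from the inverse of \<open>g^m\<close>. If there is none, \<open>H\<close> consists of powers of
  \<open>g\<close>, and so does \<open>adjoin H g = carrier G\<close>.\<close>

lemma noncyclic_length_2_basis:
  assumes fin: "finite (carrier G)"
    and noncyclic: "\<And>g. g \<in> carrier G \<Longrightarrow> \<not> carrier G \<subseteq> range (\<lambda>i::nat. g [^] i)"
  shows "\<exists>B. lattice_basis B (aug_ideal_sq G) \<and> (\<forall>x\<in>B. group_ring_length x = 2)"
proof -
  have "carrier G \<noteq> {\<one>}" using noncyclic[of \<one>] by auto
  then obtain H g m R where ext: "cyclic_extension G H g m" and g: "g \<notin> H" and R: "generating_pairs H R"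
    and adj: "adjoin H g = carrier G" using exists_maximal_extension[OF fin] by metis
  interpret cyclic_extension G H g m by (rule ext)
  have "\<exists>k\<in>H. k \<noteq> \<one> \<and> k \<otimes> g [^] m \<noteq> \<one>"
  proof (rule ccontr)
    assume H: "\<not> ?thesis"
    have ord: "g [^] (order G * m) = \<one>"
      using pow_order_eq_1[OF g_closed] by (simp add: nat_pow_pow[symmetric])
    have pos: "0 < order G" using fin order_gt_0_iff_finite by simp
    have "h \<in> range (\<lambda>i::nat. g [^] i)" if h: "h \<in> H" for h
    proof (cases "h = \<one>")
      case True
      then have "h = g [^] (0::nat)" by simp
      then show ?thesis by blast
    next
      case False
      then have "h \<otimes> g [^] m = \<one>" using H h by blast
      \<comment> \<open>The inverse of \<open>g^m\<close> is written with a natural exponent, using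
        that \<open>g\<close> to the power \<open>order G\<close> is \<open>\<one>\<close>.\<close>
      moreover have "g [^] ((order G - 1) * m) \<otimes> g [^] m = \<one>"
        using ord pos by (simp add: nat_pow_mult algebra_simps)
      ultimately have "h = g [^] ((order G - 1) * m)"
        using h by (metis H_closed g_closed nat_pow_closed r_cancel)
      then show ?thesis by blast
    qed
    then have "x \<in> range (\<lambda>i::nat. g [^] i)" if "x \<in> adjoin H g" for x
      using that by (fastforce elim!: adjoinE simp: nat_pow_mult)
    then show False using noncyclic[OF g_closed] adj by blast
  qed
  then obtain k where k: "k \<in> H" "k \<noteq> \<one>" "k \<otimes> g [^] m \<noteq> \<one>" by blast
  have "lattice_basis (case_prod aug_prod ` adjoin_pairs R H g k m) (aug_ideal_sq G)"
    using generating_pairs_lattice_basis[OF fin] generating_pairs_adjoin[OF R k(1) g] adj by simp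
  moreover have "R \<subseteq> H \<times> (H - {\<one>})" using R by (simp add: generating_pairs_def)
  then have "\<forall>x\<in>case_prod aug_prod ` adjoin_pairs R H g k m. group_ring_length x = 2"
    using length_adjoin_pairs[OF _ k g] by auto
  ultimately show ?thesis by blast
qed

text \<open>Every element of the Klein four-group squares to the identity, so the powers of
  \<open>g\<close> form at most two of the four elements.\<close>

lemma noncyclic_if_iso_Klein_four:
  assumes iso: "G \<cong> integer_mod_group 2 \<times>\<times> integer_mod_group 2" and g: "g \<in> carrier G"
  shows "\<not> carrier G \<subseteq> range (\<lambda>i::nat. g [^] i)"
proof
  let ?K = "integer_mod_group 2 \<times>\<times> integer_mod_group 2"
  assume gen: "carrier G \<subseteq> range (\<lambda>i::nat. g [^] i)"
  obtain f where f: "f \<in> iso G ?K" using iso by (auto simp: is_iso_def)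
  then have hom: "f \<in> hom G ?K" and bij: "bij_betw f (carrier G) (carrier ?K)"
    by (auto simp: iso_def)
  have sq: "y \<otimes>\<^bsub>?K\<^esub> y = \<one>\<^bsub>?K\<^esub>" if "y \<in> carrier ?K" for y
    using that by (auto simp: DirProd_def integer_mod_group_def)
  have "group ?K" by (intro DirProd_group group_integer_mod_group)
  then have "f (g \<otimes> g) = f \<one>"
    using hom_mult[OF hom g g] sq[OF hom_in_carrier[OF hom g]] hom_one[OF hom is_group] by simp
  then have "g \<otimes> g = \<one>"
    using bij g by (auto simp: bij_betw_def dest: inj_onD)
  then have "g [^] i \<in> {\<one>, g}" for i :: nat
    using g by (induction i) auto
  then have "carrier G \<subseteq> {\<one>, g}" using gen by blast
  from card_mono[OF _ this] have "card (carrier G) \<le> 2"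
    using card_insert_le_m1[of 2 "{g}" \<one>] by simp
  moreover have "card (carrier ?K) = 4"
    by (simp add: DirProd_def carrier_integer_mod_group card_cartesian_product)
  ultimately show False using bij_betw_same_card[OF bij] by simp
qed

end

theorem theorem4p3:
  fixes A :: "('a, 'm) monoid_scheme"
  assumes "comm_group A" and "finite (carrier A)"
  shows "(\<exists>B. lattice_basis B (aug_ideal_sq A) \<and>
            (\<forall>x\<in>B. \<exists>a\<in>carrier A. \<exists>b\<in>carrier A.
               x = (frag_of a - \<one>\<^bsub>group_ring A\<^esub>) \<otimes>\<^bsub>group_ring A\<^esub> (frag_of b - \<one>\<^bsub>group_ring A\<^esub>)))
       \<and> (order A > 4 \<or> A \<cong> integer_mod_group 2 \<times>\<times> integer_mod_group 2 \<longrightarrow>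
            (\<exists>B. lattice_basis B (aug_ideal_sq A) \<and> (\<forall>x\<in>B. group_ring_length x = 2)))"
proof (intro conjI impI)
  interpret comm_group A by fact
  note fin = \<open>finite (carrier A)\<close>
  obtain R where R: "R \<subseteq> carrier A \<times> carrier A" "lattice_basis (case_prod aug_prod ` R) (aug_ideal_sq A)"
    using exists_product_basis[OF fin] by blast
  have "\<exists>a\<in>carrier A. \<exists>b\<in>carrier A.
      x = (frag_of a - \<one>\<^bsub>group_ring A\<^esub>) \<otimes>\<^bsub>group_ring A\<^esub> (frag_of b - \<one>\<^bsub>group_ring A\<^esub>)"
    if "x \<in> case_prod aug_prod ` R" for x
  proof -
    from that obtain a b where "(a, b) \<in> R" "x = aug_prod a b" by auto
    moreover from this have "a \<in> carrier A" "b \<in> carrier A" using R(1) by auto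
    ultimately show ?thesis
      unfolding group_ring_simps using aug_prod_eq_mult by blast
  qed
  with R(2) show "\<exists>B. lattice_basis B (aug_ideal_sq A) \<and>
      (\<forall>x\<in>B. \<exists>a\<in>carrier A. \<exists>b\<in>carrier A.
         x = (frag_of a - \<one>\<^bsub>group_ring A\<^esub>) \<otimes>\<^bsub>group_ring A\<^esub> (frag_of b - \<one>\<^bsub>group_ring A\<^esub>))"
    by blast
  assume order: "order A > 4 \<or> A \<cong> integer_mod_group 2 \<times>\<times> integer_mod_group 2"
  show "\<exists>B. lattice_basis B (aug_ideal_sq A) \<and> (\<forall>x\<in>B. group_ring_length x = 2)"
  \<comment> \<open>If \<open>A\<close> is cyclic, it is not a Klein four-group, which leaves
    \<open>order A > 4\<close>.\<close>
  proof (cases "\<exists>g\<in>carrier A. carrier A \<subseteq> range (\<lambda>i::nat. g [^]\<^bsub>A\<^esub> i)")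
    case True
    then show ?thesis
      using order noncyclic_if_iso_Klein_four cyclic_length_2_basis[OF fin] by blast
  next
    case False
    then show ?thesis using noncyclic_length_2_basis[OF fin] by blast
  qed
qed

end
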